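(* Let $\mathcal{A}$ be a recursive algorithm enumerating a finite set $S$ and assume that $\mathcal{A}$ satisfies the Pyramid condition with respect to some potential function $\Phi$ and time $T^\star$. Then the total time spent within the recursion to enumerate $S$ is $O\bigl(|S|\,T^\star - \Phi(S)\bigr)$, where $\Phi(S)$ is the potential of the root iteration. Consequently, $\mathcal{A}$ has amortized delay $O(T^\star)$ (the total computation time divided by the number of outputs).
   Context: Setting (recursive enumeration algorithms): A recursive algorithm $\mathcal{A}$ enumerates ("visits") every element of a finite set $S$ exactly once. Its recursive calls form a recursion tree; an iteration is one execution of the recursive function, excluding the computation done inside the calls it makes recursively, and iterations are identified with nodes of the recursion tree. Each iteration is labeled by the set $X\subseteq S$ of elements visited by that iteration or any of its descendants (the root iteration is labeled $S$). In iteration $X$ a partition $X = X_1 \,\dot\cup\, \cdots \,\dot\cup\, X_m \,\dot\cup\, X'$ with $X_1,\dots,X_m\neq\emptyset$ is formed, where $X'$ (possibly empty) is the set of elements visited directly by $X$, and the function is called recursively on $X_1,\dots,X_m$ (the children of $X$, forming the set $C(X)$). $T(X)$ denotes the number of instructions executed by iteration $X$ itself. A potential function $\Phi$ assigns a number $\Phi(X)>0$ to every iteration. Pyramid condition: $\mathcal{A}$ satisfies it with respect to $\Phi$ and time $T^\star>0$ if there is a constant $\mu>0$ such that for every iteration $X$, $\sum_{Y\in C(X)} \Phi(Y) + \mu |X'| - \Phi(X) \ge T(X)/T^\star$. Only instructions executed inside the recursion are counted (not reading the input or initialization).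
   Formalization: The literal bound O(|S|T* − Φ(S)) can fail when T* < μ; proved instead: total time ≤ c|S|T* − T*Φ(S) always, ≤ c|S|T* − δΦ(S) if T* ≥ δ > 0, and the literal bound where eventually T* ≥ μ. *)

theory Defs
  imports Complex_Main "HOL-Library.Landau_Symbols"
begin

text \<open>
  A value of type \<open>'a iteration\<close> is an iteration together with the recursion tree below it: the
  elements it visits directly, the number of instructions it executes itself (those of its
  recursive calls excluded), and its recursive calls.
\<close>

datatype 'a iteration =
  Iteration (direct: "'a set") (instructions: nat) (calls: "'a iteration list")

primrec label :: "'a iteration \<Rightarrow> 'a set" where
  "label (Iteration D t cs) = D \<union> \<Union> (set (map label cs))"

primrec iterations :: "'a iteration \<Rightarrow> 'a iteration set" where
  "iterations (Iteration D t cs) = insert (Iteration D t cs) (\<Union> (set (map iterations cs)))"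

primrec total_time :: "'a iteration \<Rightarrow> nat" where
  "total_time (Iteration D t cs) = t + sum_list (map total_time cs)"

text \<open>
  That the parts cover the label of the iteration holds by definition of \<^const>\<open>label\<close>.
\<close>

definition forms_partition :: "'a iteration \<Rightarrow> bool" where
  "forms_partition X \<longleftrightarrow>
     (\<forall>Y\<in>set (calls X). label Y \<noteq> {} \<and> disjnt (label Y) (direct X)) \<and>
     (\<forall>j<length (calls X). \<forall>k<length (calls X).
        j \<noteq> k \<longrightarrow> disjnt (label (calls X ! j)) (label (calls X ! k)))"

definition enumerates :: "'a iteration \<Rightarrow> 'a set \<Rightarrow> bool" where
  "enumerates R S \<longleftrightarrow> label R = S \<and> (\<forall>X\<in>iterations R. forms_partition X)"

text \<open>
  An algorithm is given by its runs: \<open>A i\<close> is the root iteration on input \<open>i\<close>. The set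
  enumerated, the potential and the time \<open>T\<^sup>\<star>\<close> may all depend on the input; a constant is a
  number that does not depend on it.

  A potential is a function of the subtree rooted at an iteration. This is no restriction: in a
  tree satisfying \<^const>\<open>enumerates\<close>, distinct nodes carry distinct subtrees, because siblings have
  disjoint nonempty labels and a subtree is larger than each of its proper subtrees.
\<close>

definition potential_function ::
  "('i \<Rightarrow> 'a iteration) \<Rightarrow> ('i \<Rightarrow> 'a iteration \<Rightarrow> real) \<Rightarrow> bool" where
  "potential_function A \<Phi> \<longleftrightarrow> (\<forall>i. \<forall>X\<in>iterations (A i). \<Phi> i X > 0)"

definition pyramid_condition_with ::
  "real \<Rightarrow> ('i \<Rightarrow> 'a iteration) \<Rightarrow> ('i \<Rightarrow> 'a iteration \<Rightarrow> real) \<Rightarrow> ('i \<Rightarrow> real) \<Rightarrow> bool" where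
  "pyramid_condition_with \<mu> A \<Phi> Tstar \<longleftrightarrow>
     (\<forall>i. \<forall>X\<in>iterations (A i).
        (\<Sum>Y\<leftarrow>calls X. \<Phi> i Y) + \<mu> * real (card (direct X)) - \<Phi> i X
          \<ge> real (instructions X) / Tstar i)"

definition pyramid_condition ::
  "('i \<Rightarrow> 'a iteration) \<Rightarrow> ('i \<Rightarrow> 'a iteration \<Rightarrow> real) \<Rightarrow> ('i \<Rightarrow> real) \<Rightarrow> bool" where
  "pyramid_condition A \<Phi> Tstar \<longleftrightarrow> (\<exists>\<mu>>0. pyramid_condition_with \<mu> A \<Phi> Tstar)"

definition amortized_delay :: "'a iteration \<Rightarrow> real" where
  "amortized_delay R = real (total_time R) / real (card (label R))"

end

theory Submission
  imports Defs
begin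

text \<open>
  Summing the Pyramid condition over the recursion tree telescopes: every potential except that of
  the root cancels, and the directly visited elements partition the enumerated set \<open>S\<close>. Hence
  the total time is at most \<open>T\<^sup>\<star> (\<mu> |S| - \<Phi>(S))\<close>, and since \<open>\<Phi>(S) > 0\<close> the factor in front of
  \<open>\<Phi>(S)\<close> may be lowered to any positive lower bound of \<open>T\<^sup>\<star>\<close>.
\<close>

lemma root_in_iterations: "R \<in> iterations R"
  by (cases R) simp

lemma finite_label_call:
  assumes "finite (label X)" and "Y \<in> set (calls X)"
  shows "finite (label Y)"
  using assms by (cases X) auto

text \<open>The union is indexed by positions, so equal sets at different positions are covered too:
  disjoint from itself, such a set is empty and adds 0 to both sides.\<close>

lemma card_Union_nth_disjnt:
  assumes "\<forall>B\<in>set Bs. finite B"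
    and "\<forall>j<length Bs. \<forall>k<length Bs. j \<noteq> k \<longrightarrow> disjnt (Bs ! j) (Bs ! k)"
  shows "card (\<Union> (set Bs)) = (\<Sum>B\<leftarrow>Bs. card B)"
proof -
  have "\<Union> (set Bs) = (\<Union>k<length Bs. Bs ! k)"
    by (auto simp: set_conv_nth)
  also have "card \<dots> = (\<Sum>k<length Bs. card (Bs ! k))"
    using assms by (intro card_UN_disjoint) (auto simp: disjnt_def)
  also have "\<dots> = (\<Sum>B\<leftarrow>Bs. card B)"
    by (simp add: sum_list_sum_nth lessThan_atLeast0)
  finally show ?thesis .
qed

text \<open>In the induction over the tree this splits \<mu> |X| into the share of the elements
  visited directly and the shares of the recursive calls.\<close>

lemma card_label:
  assumes fin: "finite (label X)" and part: "forms_partition X"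
  shows "card (label X) = card (direct X) + (\<Sum>Y\<leftarrow>calls X. card (label Y))"
proof -
  let ?L = "\<Union> (set (map label (calls X)))"
  have label: "label X = direct X \<union> ?L"
    by (cases X) simp
  have "disjnt (direct X) ?L"
    using part by (auto simp: forms_partition_def disjnt_def)
  then have "card (label X) = card (direct X) + card ?L"
    using fin unfolding label by (auto simp: card_Un_disjnt)
  also have "card ?L = (\<Sum>B\<leftarrow>map label (calls X). card B)"
    using part finite_label_call[OF fin]
    by (intro card_Union_nth_disjnt) (auto simp: forms_partition_def)
  finally show ?thesis
    by (simp add: comp_def)
qed

lemma total_time_le:
  fixes \<mu> T :: real
  assumes "finite (label R)"
    and "\<forall>X\<in>iterations R. forms_partition X"
    and "\<forall>X\<in>iterations R. (\<Sum>Y\<leftarrow>calls X. \<phi> Y) + \<mu> * real (card (direct X)) - \<phi> X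
           \<ge> real (instructions X) / T"
  shows "real (total_time R) / T \<le> \<mu> * real (card (label R)) - \<phi> R"
  using assms
proof (induction R)
  case (Iteration D t cs)
  let ?R = "Iteration D t cs"
  have "real (total_time Y) / T \<le> \<mu> * real (card (label Y)) - \<phi> Y" if "Y \<in> set cs" for Y
    using that Iteration.prems finite_label_call[OF Iteration.prems(1)]
    by (intro Iteration.IH) auto
  then have "(\<Sum>Y\<leftarrow>cs. real (total_time Y) / T)
      \<le> (\<Sum>Y\<leftarrow>cs. \<mu> * real (card (label Y)) - \<phi> Y)"
    by (rule sum_list_mono)
  moreover have "(\<Sum>Y\<leftarrow>cs. real (total_time Y) / T) = real (\<Sum>Y\<leftarrow>cs. total_time Y) / T"
    by (induction cs) (simp_all add: add_divide_distrib)
  moreover have "(\<Sum>Y\<leftarrow>cs. \<mu> * real (card (label Y)) - \<phi> Y)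
      = \<mu> * real (\<Sum>Y\<leftarrow>cs. card (label Y)) - (\<Sum>Y\<leftarrow>cs. \<phi> Y)"
    by (induction cs) (simp_all add: algebra_simps)
  moreover have "real t / T \<le> (\<Sum>Y\<leftarrow>cs. \<phi> Y) + \<mu> * real (card D) - \<phi> ?R"
    using Iteration.prems(3) by simp
  moreover have "card (label ?R) = card D + (\<Sum>Y\<leftarrow>cs. card (label Y))"
    using card_label[OF Iteration.prems(1)] Iteration.prems(2) by simp
  \<comment> \<open>The potentials of the calls enter positively through the Pyramid condition at
    the root and negatively through the summed induction hypotheses, so they cancel. The label of
    \<open>?R\<close> stays folded so that the equation for its cardinality applies.\<close>
  ultimately show ?case
    by (simp del: label.simps add: add_divide_distrib distrib_left)
qed

text \<open>The telescoped bound is \<open>Tstar\<close> (\<mu> |S| - \<Phi>(S)). Reading it as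
  O(|S| \<open>Tstar\<close> - \<Phi>(S)) can fail when \<open>Tstar\<close> < \<mu>: one iteration
  visiting one element with one instruction, \<Phi> = \<open>Tstar\<close> = 1 and \<mu> = 2 meets
  the Pyramid condition, yet |S| \<open>Tstar\<close> - \<Phi>(S) = 0. Hence the bounds with
  explicit factors, and the O-form where eventually \<mu> \<le> \<open>Tstar\<close>.\<close>

theorem theorem2p4:
  fixes A :: "'i \<Rightarrow> 'a iteration" and S :: "'i \<Rightarrow> 'a set"
    and \<Phi> :: "'i \<Rightarrow> 'a iteration \<Rightarrow> real" and Tstar :: "'i \<Rightarrow> real"
  assumes finite: "\<And>i. finite (S i)"
    and enumerates: "\<And>i. enumerates (A i) (S i)"
    and potential: "potential_function A \<Phi>"
    and Tstar_pos: "\<And>i. Tstar i > 0"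
    and pyramid: "pyramid_condition A \<Phi> Tstar"
  shows "(\<exists>c>0. \<forall>i. real (total_time (A i))
            \<le> c * (real (card (S i)) * Tstar i) - Tstar i * \<Phi> i (A i)) \<and>
         (\<forall>\<delta>>0. (\<forall>i. \<delta> \<le> Tstar i) \<longrightarrow>
            (\<exists>c>0. \<forall>i. real (total_time (A i))
               \<le> c * (real (card (S i)) * Tstar i) - \<delta> * \<Phi> i (A i))) \<and>
         (\<forall>\<mu>>0. pyramid_condition_with \<mu> A \<Phi> Tstar \<longrightarrow>
            (\<forall>F. (\<forall>\<^sub>F i in F. \<mu> \<le> Tstar i) \<longrightarrow>
            (\<forall>\<^sub>F i in F. 0 \<le> real (card (S i)) * Tstar i - \<Phi> i (A i)) \<and>
            (\<lambda>i. real (total_time (A i)))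
               \<in> O[F](\<lambda>i. real (card (S i)) * Tstar i - \<Phi> i (A i)))) \<and>
         (\<lambda>i. amortized_delay (A i)) \<in> O[top](Tstar)"
proof -
  have time_bound: "real (total_time (A i)) \<le> Tstar i * (\<mu> * real (card (S i)) - \<Phi> i (A i))"
    if "pyramid_condition_with \<mu> A \<Phi> Tstar" for \<mu> i
  proof -
    have "real (total_time (A i)) / Tstar i \<le> \<mu> * real (card (label (A i))) - \<Phi> i (A i)"
      using that finite enumerates
      by (intro total_time_le) (simp_all add: enumerates_def pyramid_condition_with_def)
    then show ?thesis
      using enumerates Tstar_pos by (simp add: enumerates_def pos_divide_le_eq mult.commute)
  qed
  have root_pos: "\<Phi> i (A i) > 0" for i
    using potential root_in_iterations by (auto simp: potential_function_def)
  have weakened: "real (total_time (A i)) \<le> \<mu> * (real (card (S i)) * Tstar i) - \<delta> * \<Phi> i (A i)"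
    if "pyramid_condition_with \<mu> A \<Phi> Tstar" and "\<delta> \<le> Tstar i" for \<mu> \<delta> i
  proof -
    have "\<delta> * \<Phi> i (A i) \<le> Tstar i * \<Phi> i (A i)"
      using that(2) root_pos[of i] by (intro mult_right_mono) auto
    then show ?thesis
      using time_bound[OF that(1), of i] by (simp add: algebra_simps)
  qed
  obtain \<mu> where \<mu>: "\<mu> > 0" "pyramid_condition_with \<mu> A \<Phi> Tstar"
    using pyramid by (auto simp: pyramid_condition_def)
  show ?thesis
  proof (intro conjI allI impI)
    show "\<exists>c>0. \<forall>i. real (total_time (A i))
        \<le> c * (real (card (S i)) * Tstar i) - Tstar i * \<Phi> i (A i)"
      \<comment> \<open>Here c = \<mu>, and \<delta> in \<open>weakened\<close> may vary with the
        input: it is \<open>Tstar i\<close>.\<close>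
      using \<mu> weakened by blast
  next
    fix \<delta> :: real
    assume "\<forall>i. \<delta> \<le> Tstar i"
    then show "\<exists>c>0. \<forall>i. real (total_time (A i))
        \<le> c * (real (card (S i)) * Tstar i) - \<delta> * \<Phi> i (A i)"
      using \<mu> weakened by blast
  next
    fix \<nu> :: real and F
    assume \<nu>: "\<nu> > 0" "pyramid_condition_with \<nu> A \<Phi> Tstar" and F: "\<forall>\<^sub>F i in F. \<nu> \<le> Tstar i"
    \<comment> \<open>The choice \<delta> = \<nu> gives both terms the same factor, which can then
      be pulled out.\<close>
    have bound: "real (total_time (A i)) \<le> \<nu> * (real (card (S i)) * Tstar i - \<Phi> i (A i))"
      if "\<nu> \<le> Tstar i" for i
      using weakened[OF \<nu>(2) that] by (simp add: right_diff_distrib)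
    \<comment> \<open>A running time is nonnegative and \<nu> > 0, so \<open>bound\<close> itself
      forces the difference to be nonnegative. This removes the norm in the O-estimate.\<close>
    then have nonneg: "0 \<le> real (card (S i)) * Tstar i - \<Phi> i (A i)" if "\<nu> \<le> Tstar i" for i
    proof -
      have "0 \<le> \<nu> * (real (card (S i)) * Tstar i - \<Phi> i (A i))"
        using bound[OF that] by linarith
      then show ?thesis
        using \<nu>(1) by (simp add: zero_le_mult_iff)
    qed
    show "\<forall>\<^sub>F i in F. 0 \<le> real (card (S i)) * Tstar i - \<Phi> i (A i)"
      using F by eventually_elim (rule nonneg)
    show "(\<lambda>i. real (total_time (A i))) \<in> O[F](\<lambda>i. real (card (S i)) * Tstar i - \<Phi> i (A i))"
    proof (rule bigoI)
      show "\<forall>\<^sub>F i in F. norm (real (total_time (A i)))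
          \<le> \<nu> * norm (real (card (S i)) * Tstar i - \<Phi> i (A i))"
        using F by eventually_elim (simp only: real_norm_def abs_of_nonneg[OF nonneg] abs_of_nat bound)
    qed
  next
    have "amortized_delay (A i) \<le> \<mu> * Tstar i" for i
    \<comment> \<open>In the zero case the quotient is 0 by the convention for division by zero.
      Otherwise \<delta> = 0 drops the potential before dividing by |S|.\<close>
    proof (cases "card (S i) = 0")
      case True
      then show ?thesis
        using \<mu>(1) Tstar_pos[of i] enumerates[of i]
        by (simp add: amortized_delay_def enumerates_def)
    next
      case False
      then show ?thesis
        using weakened[OF \<mu>(2), of 0 i] Tstar_pos[of i] enumerates[of i]
        by (simp add: amortized_delay_def enumerates_def field_simps)
    qed
    then show "(\<lambda>i. amortized_delay (A i)) \<in> O[top](Tstar)"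
      using Tstar_pos
      by (intro bigoI[of _ \<mu>]) (simp add: amortized_delay_def less_imp_le)
  qed
qed

end
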